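(* Let $E_\star\in\mathcal S$ with $\|E_\star\|_F=1$ be such that the target eigenvalue $\lambda(A+\varepsilon E_\star)$ is simple and $G_\varepsilon^{\mathcal S}(E_\star)\neq 0$. Let $E(t)\in\mathcal S$ be the solution of the differential equation $$\dot E=-G_\varepsilon^{\mathcal S}(E)+\operatorname{Re}\langle G_\varepsilon^{\mathcal S}(E),E\rangle\,E \qquad ( * )$$ passing through $E_\star$, say $E(t_0)=E_\star$. Then the following are equivalent: 1. $\frac{d}{dt}F_\varepsilon(E(t))=0$ at $t=t_0$. 2. $E_\star$ is a stationary point of the differential equation $( * )$. 3. $E_\star$ is a real multiple of $G_\varepsilon^{\mathcal S}(E_\star)$.
   Context: $A\in\mathbb{C}^{n\times n}$ is given, $\varepsilon>0$, and $\mathcal S\subset\mathbb{C}^{n\times n}$ is a (real- or complex-linear) subspace. $\langle X,Y\rangle=\operatorname{tr}(X^*Y)$, $\|X\|_F=\langle X,X\rangle^{1/2}$. $\Pi^{\mathcal S}$ is the orthogonal projection onto $\mathcal S$ with respect to $\operatorname{Re}\langle\cdot,\cdot\rangle$. $\lambda(M)$ denotes a chosen target eigenvalue of a matrix $M$ (e.g. an eigenvalue of largest real part, or of largest or smallest modulus); near a matrix $E$ where the target eigenvalue of $A+\varepsilon E$ is simple, it is taken to depend continuously on $E$. $f:\mathbb{C}^2\to\mathbb{C}$ is smooth with $f(z,\overline z)=f(\overline z,z)\in\mathbb{R}$ for all $z\in\mathbb{C}$, and $F_\varepsilon(E)=f(\lambda,\overline\lambda)$ with $\lambda=\lambda(A+\varepsilon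 E)$. When $\lambda$ is simple, let $x,y$ be left and right eigenvectors of $A+\varepsilon E$ for $\lambda$ (i.e. $x^*(A+\varepsilon E)=\lambda x^*$, $(A+\varepsilon E)y=\lambda y$) normalized by $\|x\|=\|y\|=1$ and $x^*y>0$; set $G_\varepsilon(E)=2f_{\overline\lambda}\,xy^*$ with $f_{\overline\lambda}=\frac{\partial f}{\partial\overline\lambda}(\lambda,\overline\lambda)$ (the Wirtinger derivative of $z\mapsto f(z,\overline z)$ with respect to $\overline z$), which does not depend on the choice of normalized eigenvectors, and $G_\varepsilon^{\mathcal S}(E)=\Pi^{\mathcal S}G_\varepsilon(E)$. A stationary point of a differential equation is a point where its right-hand side vanishes. *)

theory Defs
  imports "HOL-Analysis.Analysis" "HOL-Computational_Algebra.Polynomial"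
begin

definition cnj_vec :: "complex^'n \<Rightarrow> complex^'n" where
  "cnj_vec x = (\<chi> i. cnj (x $ i))"

definition conj_transpose :: "complex^'n^'m \<Rightarrow> complex^'m^'n" where
  "conj_transpose M = (\<chi> i j. cnj (M $ j $ i))"

definition frob_inner :: "complex^'n^'n \<Rightarrow> complex^'n^'n \<Rightarrow> complex" where
  "frob_inner X Y = trace (conj_transpose X ** Y)"

definition frob_norm :: "complex^'n^'n \<Rightarrow> real" where
  "frob_norm X = sqrt (Re (frob_inner X X))"

text \<open>The library's real inner product and norm on \<^typ>\<open>complex^'n^'n\<close> are
  the real part of the Frobenius inner product and the Frobenius norm, so the library
  topology and derivatives are the intended ones.\<close>

lemma Re_frob_inner: "Re (frob_inner X Y) = inner X Y"
proof -
  have "Re (frob_inner X Y) = (\<Sum>i\<in>UNIV. \<Sum>k\<in>UNIV. inner (X $ k $ i) (Y $ k $ i))"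
    by (simp add: frob_inner_def trace_def conj_transpose_def matrix_matrix_mult_def inner_complex_def)
  also have "\<dots> = inner X Y"
    unfolding inner_vec_def by (rule sum.swap)
  finally show ?thesis .
qed

lemma frob_norm_eq_norm: "frob_norm X = norm X"
  by (simp add: frob_norm_def Re_frob_inner norm_eq_sqrt_inner)

text \<open>\<open>S\<close> is a real subspace; complex-linear subspaces are a special case.\<close>

definition frob_proj :: "(complex^'n^'n) set \<Rightarrow> complex^'n^'n \<Rightarrow> complex^'n^'n" where
  "frob_proj S Z = (THE P. P \<in> S \<and> (\<forall>W\<in>S. Re (frob_inner (Z - P) W) = 0))"

lemma frob_proj:
  assumes "subspace S"
  shows "frob_proj S Z \<in> S \<and> (\<forall>W\<in>S. Re (frob_inner (Z - frob_proj S Z) W) = 0)"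
proof -
  have sp: "span S = S"
    using assms by (simp add: span_eq_iff)
  obtain P Q where PQ: "P \<in> span S" "\<And>W. W \<in> span S \<Longrightarrow> orthogonal Q W" "Z = P + Q"
    using orthogonal_subspace_decomp_exists[of S Z] by blast
  let ?R = "\<lambda>P. P \<in> S \<and> (\<forall>W\<in>S. Re (frob_inner (Z - P) W) = 0)"
  have ex: "?R P"
    using PQ sp by (auto simp: Re_frob_inner orthogonal_def)
  have "P' = P" if "?R P'" for P'
  proof -
    have S: "P - P' \<in> S"
      using ex that assms by (auto intro: subspace_diff)
    then have "inner (Z - P') (P - P') = 0" "inner (Z - P) (P - P') = 0"
      using ex that by (auto simp: Re_frob_inner)
    then have "inner (P - P') (P - P') = 0"
      by (simp add: inner_diff_left)
    then show ?thesis by simp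
  qed
  then show ?thesis
    unfolding frob_proj_def by (intro theI[of ?R P] ex)
qed

definition is_eigenvalue :: "complex^'n^'n \<Rightarrow> complex \<Rightarrow> bool" where
  "is_eigenvalue M \<mu> \<longleftrightarrow> (\<exists>v. v \<noteq> 0 \<and> M *v v = \<mu> *s v)"

definition charpoly :: "complex^'n^'n \<Rightarrow> complex poly" where
  "charpoly M = det (mat [:0, 1:] - (\<chi> i j. [:M $ i $ j:]))"

definition simple_eigenvalue :: "complex^'n^'n \<Rightarrow> complex \<Rightarrow> bool" where
  "simple_eigenvalue M \<mu> \<longleftrightarrow> is_eigenvalue M \<mu> \<and> order \<mu> (charpoly M) = 1"

text \<open>\<open>x\<close> is a left and \<open>y\<close> a right eigenvector.  The order on
  \<^typ>\<open>complex\<close> is not used; positivity of \<open>x\<^sup>* y\<close> is spelled out.\<close>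

definition normalized_eigvecs :: "complex^'n^'n \<Rightarrow> complex \<Rightarrow> complex^'n \<Rightarrow> complex^'n \<Rightarrow> bool" where
  "normalized_eigvecs M \<mu> x y \<longleftrightarrow>
     cnj_vec x v* M = \<mu> *s cnj_vec x \<and> M *v y = \<mu> *s y \<and>
     norm x = 1 \<and> norm y = 1 \<and>
     (let s = (\<Sum>i\<in>UNIV. cnj (x $ i) * y $ i) in s \<in> \<real> \<and> Re s > 0)"

text \<open>Smoothness is in the real sense (\<open>C\<^sup>\<infinity>\<close>), not holomorphy.  In finite dimension,
  being \<open>C\<^sup>k\<^sup>+\<^sup>1\<close> means being differentiable with all directional derivatives
  \<open>C\<^sup>k\<close>.\<close>

primrec times_cont_diff :: "nat \<Rightarrow> ('a::euclidean_space \<Rightarrow> 'b::real_normed_vector) \<Rightarrow> bool" where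
  "times_cont_diff 0 f \<longleftrightarrow> continuous_on UNIV f"
| "times_cont_diff (Suc k) f \<longleftrightarrow>
     (\<forall>x. f differentiable (at x)) \<and>
     (\<forall>v. times_cont_diff k (\<lambda>x. frechet_derivative f (at x) v))"

definition smooth_fun :: "('a::euclidean_space \<Rightarrow> 'b::real_normed_vector) \<Rightarrow> bool" where
  "smooth_fun f \<longleftrightarrow> (\<forall>k. times_cont_diff k f)"

text \<open>The Wirtinger derivative \<open>\<partial>g/\<partial>z\<^sup>- = (\<partial>g/\<partial>x + i \<partial>g/\<partial>y) / 2\<close>, where \<open>z = x + i y\<close>.\<close>

definition wirtinger_cnj :: "(complex \<Rightarrow> complex) \<Rightarrow> complex \<Rightarrow> complex" where
  "wirtinger_cnj g z =
     (frechet_derivative g (at z) 1 + \<i> * frechet_derivative g (at z) \<i>) / 2"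

text \<open>In the following, \<open>lam M\<close> is the target eigenvalue of the matrix \<open>M\<close>.\<close>

definition F_eps ::
  "(complex \<times> complex \<Rightarrow> complex) \<Rightarrow> (complex^'n^'n \<Rightarrow> complex) \<Rightarrow> complex^'n^'n \<Rightarrow> real \<Rightarrow>
   complex^'n^'n \<Rightarrow> complex" where
  "F_eps f lam A \<epsilon> E = (let l = lam (A + \<epsilon> *\<^sub>R E) in f (l, cnj l))"

text \<open>Which normalized pair of eigenvectors is picked does not matter: for a simple eigenvalue,
  \<open>x\<close> and \<open>y\<close> are unique up to a common unimodular factor, which cancels in \<open>x y\<^sup>*\<close>.
  For a non-simple target eigenvalue the value of the gradient is irrelevant.\<close>

definition G_eps ::
  "(complex \<times> complex \<Rightarrow> complex) \<Rightarrow> (complex^'n^'n \<Rightarrow> complex) \<Rightarrow> complex^'n^'n \<Rightarrow> real \<Rightarrow>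
   complex^'n^'n \<Rightarrow> complex^'n^'n" where
  "G_eps f lam A \<epsilon> E =
     (let M = A + \<epsilon> *\<^sub>R E; l = lam M;
          (x, y) = (SOME (x, y). normalized_eigvecs M l x y)
      in \<chi> i j. 2 * wirtinger_cnj (\<lambda>z. f (z, cnj z)) l * (x $ i * cnj (y $ j)))"

definition GS_eps ::
  "(complex^'n^'n) set \<Rightarrow> (complex \<times> complex \<Rightarrow> complex) \<Rightarrow> (complex^'n^'n \<Rightarrow> complex) \<Rightarrow>
   complex^'n^'n \<Rightarrow> real \<Rightarrow> complex^'n^'n \<Rightarrow> complex^'n^'n" where
  "GS_eps S f lam A \<epsilon> E = frob_proj S (G_eps f lam A \<epsilon> E)"

definition flow_rhs ::
  "(complex^'n^'n) set \<Rightarrow> (complex \<times> complex \<Rightarrow> complex) \<Rightarrow> (complex^'n^'n \<Rightarrow> complex) \<Rightarrow>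
   complex^'n^'n \<Rightarrow> real \<Rightarrow> complex^'n^'n \<Rightarrow> complex^'n^'n" where
  "flow_rhs S f lam A \<epsilon> E =
     - GS_eps S f lam A \<epsilon> E + Re (frob_inner (GS_eps S f lam A \<epsilon> E) E) *\<^sub>R E"

definition ode_solution_on :: "real set \<Rightarrow> ('a::real_normed_vector \<Rightarrow> 'a) \<Rightarrow> (real \<Rightarrow> 'a) \<Rightarrow> bool" where
  "ode_solution_on T rhs E \<longleftrightarrow> (\<forall>t\<in>T. (E has_vector_derivative rhs (E t)) (at t within T))"

definition stationary_point :: "('a::real_normed_vector \<Rightarrow> 'a) \<Rightarrow> 'a \<Rightarrow> bool" where
  "stationary_point rhs p \<longleftrightarrow> rhs p = 0"

end

theory Submission
  imports Defs
begin

text \<open>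
  Let \<open>\<mu>\<close> be a simple eigenvalue of \<open>M\<close> with right eigenvector \<open>y\<close>, where \<open>y\<^sub>k \<noteq> 0\<close>, and let \<open>B\<close> be
  \<open>\<mu> I - M\<close> with column \<open>k\<close> replaced by \<open>y\<close>.  Replacing that column in \<open>z I - M\<close>, Cramer's rule
  shows that simplicity makes \<open>B\<close> invertible.  Hence \<open>x\<^sup>* y \<noteq> 0\<close> for a left eigenvector \<open>x\<close>, and for
  nearby matrices the eigenvector with \<open>k\<close>-th entry \<open>1\<close> solves a linear system with an invertible
  matrix, so it depends continuously on the matrix.  Applying \<open>x\<^sup>*\<close> to the eigenvalue equation
  gives \<open>\<lambda>' = x\<^sup>* M' y / x\<^sup>* y\<close>, and therefore
  \<open>d/dt F = (\<epsilon> / x\<^sup>* y) Re \<langle>G, E'\<rangle>\<close>.  With \<open>P = \<Pi> G\<close> and \<open>D = -P + Re \<langle>P, E\<rangle> E\<close>, where \<open>\<parallel>E\<parallel> = 1\<close>, one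
  has \<open>Re \<langle>G, D\<rangle> = Re \<langle>P, D\<rangle> = -\<parallel>D\<parallel>\<^sup>2\<close>, so the derivative of \<open>F\<close> along the flow vanishes only where the
  right-hand side does.
\<close>

subsection \<open>Simple roots of the characteristic polynomial\<close>

text \<open>The body has the shape of the matrices in \<open>cramer\<close> and
  \<open>cramer_lemma\<close>, so that Cramer's rule applies after unfolding.\<close>

definition replace_column :: "'a^'n^'m \<Rightarrow> 'n \<Rightarrow> 'a^'m \<Rightarrow> 'a^'n^'m" where
  "replace_column A k v = (\<chi> i j. if j = k then v $ i else A $ i $ j)"

lemma poly_charpoly: "poly (charpoly M) z = det (mat z - M)"
  unfolding charpoly_def det_def
  by (auto simp: poly_sum poly_prod mat_def intro!: sum.cong prod.cong)

lemma norm_vector_scalar_mult: "norm (c *s (v :: complex^'n)) = norm c * norm v"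
  by (simp add: norm_vec_def norm_mult L2_set_right_distrib)

text \<open>An operator bound for \<open>M\<close> bounds all its eigenvalues. This rules out a
  vanishing characteristic polynomial, for which every complex number would be an
  eigenvalue.\<close>

lemma eigenvalue_bound:
  fixes M :: "complex^'n^'n"
  obtains K where "\<And>\<mu>. is_eigenvalue M \<mu> \<Longrightarrow> norm \<mu> \<le> K"
proof -
  obtain K where K: "\<And>v. norm (M *v v) \<le> norm v * K"
    using bounded_linear.bounded[OF matrix_vector_mul_bounded_linear[of M]] by blast
  have "norm \<mu> \<le> K" if ev: "is_eigenvalue M \<mu>" for \<mu>
  proof -
    obtain v where v: "v \<noteq> 0" "M *v v = \<mu> *s v"
      using ev by (auto simp: is_eigenvalue_def)
    with K[of v] show ?thesis by (simp add: norm_vector_scalar_mult mult.commute)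
  qed
  then show ?thesis by (rule that)
qed

lemma mat_mult_vec: "mat z *v v = z *s (v :: 'a::comm_ring_1^'n)"
  by (vector matrix_vector_mult_def mat_def) (simp add: if_distrib if_distribR sum.delta cong: if_cong)

lemma vec_mult_mat: "v v* mat z = z *s (v :: 'a::comm_ring_1^'n)"
  by (vector vector_matrix_mult_def mat_def) (simp add: if_distrib if_distribR sum.delta mult.commute cong: if_cong)

lemma det_eq_0_iff_kernel:
  fixes A :: "'a::field^'n^'n"
  shows "det A = 0 \<longleftrightarrow> (\<exists>v. v \<noteq> 0 \<and> A *v v = 0)"
  by (metis invertible_det_nz invertible_left_inverse matrix_left_invertible_ker)

lemma det_eq_0_iff_left_kernel:
  fixes A :: "'a::field^'n^'n"
  shows "det A = 0 \<longleftrightarrow> (\<exists>v. v \<noteq> 0 \<and> v v* A = 0)"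
  using det_eq_0_iff_kernel[of "transpose A"] by (simp add: det_transpose)

lemma is_eigenvalue_iff_charpoly: "is_eigenvalue M \<mu> \<longleftrightarrow> poly (charpoly M) \<mu> = 0"
  unfolding poly_charpoly det_eq_0_iff_kernel is_eigenvalue_def
  by (auto simp: matrix_vector_mult_diff_rdistrib mat_mult_vec)

text \<open>Needed because \<^const>\<open>order\<close> is unspecified on the zero polynomial.\<close>

lemma charpoly_nonzero: "charpoly M \<noteq> 0"
proof
  assume "charpoly M = 0"
  then have "is_eigenvalue M \<mu>" for \<mu>
    by (simp add: is_eigenvalue_iff_charpoly)
  moreover obtain K where "\<And>\<mu>. is_eigenvalue M \<mu> \<Longrightarrow> norm \<mu> \<le> K"
    using eigenvalue_bound by blast
  ultimately have "norm (of_real (\<bar>K\<bar> + 1) :: complex) \<le> K"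
    by blast
  then show False by simp
qed

lemma det_replace_column_mult:
  fixes A :: "'a::comm_ring_1^'n^'n"
  shows "det (replace_column A k (c *s v)) = c * det (replace_column A k v)"
proof -
  have *: "transpose (replace_column A k w) = (\<chi> i. if i = k then w else transpose A $ i)" for w
    by (simp add: replace_column_def transpose_def vec_eq_iff)
  have "det (transpose (replace_column A k (c *s v))) = c * det (transpose (replace_column A k v))"
    unfolding * by (rule det_row_mul)
  then show ?thesis by (simp add: det_transpose)
qed

lemma det_replace_column_image:
  fixes A :: "'a::field^'n^'n"
  shows "det (replace_column A k (A *v x)) = x $ k * det A"
  unfolding replace_column_def by (rule cramer_lemma)

lemma tendsto_det:
  fixes A :: "'b \<Rightarrow> complex^'n^'n"
  assumes "(A \<longlongrightarrow> A0) F"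
  shows "((\<lambda>t. det (A t)) \<longlongrightarrow> det A0) F"
  unfolding det_def
  by (intro tendsto_intros assms)

lemma tendsto_replace_column:
  fixes A :: "'b \<Rightarrow> complex^'n^'n"
  assumes "(A \<longlongrightarrow> A0) F" "(v \<longlongrightarrow> v0) F"
  shows "((\<lambda>t. replace_column (A t) k (v t)) \<longlongrightarrow> replace_column A0 k v0) F"
  unfolding replace_column_def
  by (intro tendsto_vec_lambda) (auto intro!: tendsto_intros assms)

lemma tendsto_mat:
  fixes z :: "'b \<Rightarrow> complex"
  assumes "(z \<longlongrightarrow> z0) F"
  shows "((\<lambda>t. mat (z t)) \<longlongrightarrow> (mat z0 :: complex^'n^'n)) F"
  unfolding mat_def
  by (intro tendsto_vec_lambda) (auto intro!: tendsto_intros assms)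

text \<open>Order one means that the characteristic polynomial is \<open>z - \<mu>\<close> times
  some \<open>q\<close> with \<open>poly q \<mu> \<noteq> 0\<close>. Cramer's rule identifies the
  determinant in question with \<open>y $ k * poly q \<mu>\<close>.\<close>

lemma det_replace_column_eigenvector_nonzero:
  fixes M :: "complex^'n^'n"
  assumes "simple_eigenvalue M \<mu>" "M *v y = \<mu> *s y" "y $ k \<noteq> 0"
  shows "det (replace_column (mat \<mu> - M) k y) \<noteq> 0"
proof -
  let ?B = "\<lambda>z. replace_column (mat z - M) k y"
  obtain q where q: "charpoly M = [:- \<mu>, 1:] ^ order \<mu> (charpoly M) * q" "\<not> [:- \<mu>, 1:] dvd q"
    using order_decomp[OF charpoly_nonzero] by blast
  then have q\<mu>: "poly q \<mu> \<noteq> 0" and charpoly: "charpoly M = [:- \<mu>, 1:] * q"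
    using assms(1) by (auto simp: simple_eigenvalue_def poly_eq_0_iff_dvd)
  have eq: "det (?B z) = y $ k * poly q z" if "z \<noteq> \<mu>" for z
  proof -
    have "(mat z - M) *v y = (z - \<mu>) *s y"
      by (simp add: matrix_vector_mult_diff_rdistrib mat_mult_vec assms(2) vector_sub_rdistrib)
    \<comment> \<open>Both sides are the determinant with column \<open>k\<close> replaced by
      \<open>(mat z - M) *v y\<close>: the left one by linearity in that column, the right one by
      Cramer's rule.\<close>
    then have "(z - \<mu>) * det (?B z) = y $ k * det (mat z - M)"
      using det_replace_column_image[of "mat z - M" k y] det_replace_column_mult by metis
    also have "\<dots> = (z - \<mu>) * (y $ k * poly q z)"
      by (simp flip: poly_charpoly add: charpoly) (simp add: algebra_simps)
    finally show ?thesis using that by simp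
  qed
  \<comment> \<open>Cancelling \<open>z - \<mu>\<close> requires \<open>z \<noteq> \<mu>\<close>, so
    the value at \<open>\<mu>\<close> is recovered as a limit.\<close>
  have "((\<lambda>z. det (?B z)) \<longlongrightarrow> det (?B \<mu>)) (at \<mu>)"
    by (intro tendsto_intros tendsto_det tendsto_replace_column tendsto_mat)
  moreover have "((\<lambda>z. det (?B z)) \<longlongrightarrow> y $ k * poly q \<mu>) (at \<mu>)"
    by (rule Lim_transform_eventually[of "\<lambda>z. y $ k * poly q z"])
      (auto simp: eq eventually_at_filter intro!: tendsto_intros)
  ultimately have "det (?B \<mu>) = y $ k * poly q \<mu>"
    by (rule LIM_unique)
  then show ?thesis using q\<mu> assms(3) by simp
qed

text \<open>If the pairing vanished, \<open>x\<close> would annihilate the columns of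
  \<open>mat \<mu> - M\<close> and also the replacing column \<open>y\<close>, against the
  invertibility just shown. Since \<open>scalar_product\<close> does not conjugate, \<open>x\<close>
  stands for the conjugate of a left eigenvector in the sense of
  \<open>normalized_eigvecs\<close>.\<close>

lemma left_right_eigenvectors_not_orthogonal:
  fixes M :: "complex^'n^'n"
  assumes "simple_eigenvalue M \<mu>" "M *v y = \<mu> *s y" "y \<noteq> 0" "x v* M = \<mu> *s x" "x \<noteq> 0"
  shows "scalar_product x y \<noteq> 0"
proof
  assume xy: "scalar_product x y = 0"
  obtain k where k: "y $ k \<noteq> 0"
    using assms(3) by (auto simp: vec_eq_iff)
  have N: "x v* (mat \<mu> - M) = 0"
    by (simp add: vector_matrix_mult_diff_rdistrib vec_mult_mat assms(4))
  have "(x v* replace_column (mat \<mu> - M) k y) $ j = 0" for j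
  proof (cases "j = k")
    case True
    then show ?thesis
      using xy by (simp add: vector_matrix_mult_def replace_column_def scalar_product_def mult.commute)
  next
    case False
    then have "(x v* replace_column (mat \<mu> - M) k y) $ j = (x v* (mat \<mu> - M)) $ j"
      by (simp add: vector_matrix_mult_def replace_column_def)
    then show ?thesis by (simp add: N)
  qed
  then have "x v* replace_column (mat \<mu> - M) k y = 0"
    by (simp add: vec_eq_iff)
  then have "det (replace_column (mat \<mu> - M) k y) = 0"
    using assms(5) det_eq_0_iff_left_kernel by blast
  then show False
    using det_replace_column_eigenvector_nonzero[OF assms(1,2) k] by simp
qed

subsection \<open>Differentiability of a simple eigenvalue\<close>

text \<open>Cramer's rule writes the solution as quotients of determinants, which are continuous in
  the matrix and the right-hand side as long as the denominator stays away from zero.\<close>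

lemma tendsto_solve_linear_system:
  fixes A :: "'b \<Rightarrow> complex^'n^'n"
  assumes "(A \<longlongrightarrow> A0) F" "(b \<longlongrightarrow> A0 *v v0) F" "det A0 \<noteq> 0"
    and "\<forall>\<^sub>F t in F. A t *v v t = b t"
  shows "(v \<longlongrightarrow> v0) F"
proof -
  let ?sol = "\<lambda>A b. \<chi> k. det (replace_column A k b) / det A"
  have "v0 = ?sol A0 (A0 *v v0)"
    using cramer[OF assms(3), of v0 "A0 *v v0"] by (simp add: replace_column_def)
  moreover have "((\<lambda>t. ?sol (A t) (b t)) \<longlongrightarrow> ?sol A0 (A0 *v v0)) F"
    by (intro tendsto_vec_lambda tendsto_intros tendsto_det tendsto_replace_column assms)
  moreover have "\<forall>\<^sub>F t in F. ?sol (A t) (b t) = v t"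
    using assms(4) tendsto_imp_eventually_ne[OF tendsto_det[OF assms(1)] assms(3)]
  proof eventually_elim
    case (elim t)
    then show ?case using cramer[of "A t" "v t" "b t"] by (simp add: replace_column_def)
  qed
  ultimately show ?thesis
    using Lim_transform_eventually by fastforce
qed

text \<open>In this form a derivative can be computed with the limit rules alone.\<close>

lemma has_vector_derivative_iff_quotient:
  fixes f :: "real \<Rightarrow> 'a::real_normed_vector"
  shows "(f has_vector_derivative d) (at t) \<longleftrightarrow>
    ((\<lambda>s. (f s - f t) /\<^sub>R (s - t)) \<longlongrightarrow> d) (at t)"
proof -
  have *: "norm (f s - f t - (s - t) *\<^sub>R d) / norm (s - t) = norm ((f s - f t) /\<^sub>R (s - t) - d)"
    if "s \<noteq> t" for s
  proof -
    have "(f s - f t) /\<^sub>R (s - t) - d = (f s - f t - (s - t) *\<^sub>R d) /\<^sub>R (s - t)"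
      using that by (simp add: scaleR_diff_right)
    then show ?thesis by (simp add: divide_inverse mult.commute)
  qed
  have "(f has_vector_derivative d) (at t) \<longleftrightarrow>
      ((\<lambda>s. norm (f s - f t - (s - t) *\<^sub>R d) / norm (s - t)) \<longlongrightarrow> 0) (at t)"
    by (simp add: has_vector_derivative_def has_derivative_iff_norm bounded_linear_scaleR_left)
  also have "\<dots> \<longleftrightarrow> ((\<lambda>s. norm ((f s - f t) /\<^sub>R (s - t) - d)) \<longlongrightarrow> 0) (at t)"
    by (intro tendsto_cong) (simp add: eventually_at_filter * [unfolded real_norm_def])
  finally show ?thesis
    by (simp add: tendsto_norm_zero_iff LIM_zero_iff)
qed

lemma tendsto_matrix_vector_mult:
  fixes A :: "'b \<Rightarrow> complex^'n^'m"
  assumes "(A \<longlongrightarrow> A0) F" "(v \<longlongrightarrow> v0) F"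
  shows "((\<lambda>t. A t *v v t) \<longlongrightarrow> A0 *v v0) F"
  unfolding matrix_vector_mult_def
  by (intro tendsto_vec_lambda tendsto_intros assms)

lemma tendsto_scalar_product:
  fixes v w :: "'b \<Rightarrow> complex^'n"
  assumes "(v \<longlongrightarrow> v0) F" "(w \<longlongrightarrow> w0) F"
  shows "((\<lambda>t. scalar_product (v t) (w t)) \<longlongrightarrow> scalar_product v0 w0) F"
  unfolding scalar_product_def
  by (intro tendsto_intros assms)

lemma scalar_product_vector_matrix:
  fixes x :: "'a::comm_ring_1^'m"
  shows "scalar_product (x v* M) v = scalar_product x (M *v v)"
proof -
  have "scalar_product (x v* M) v = (\<Sum>j\<in>UNIV. \<Sum>i\<in>UNIV. x $ i * (M $ i $ j * v $ j))"
    by (simp add: scalar_product_def vector_matrix_mult_def sum_distrib_right sum_distrib_left mult_ac)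
  also have "\<dots> = scalar_product x (M *v v)"
    by (subst sum.swap) (simp add: scalar_product_def matrix_vector_mult_def sum_distrib_left)
  finally show ?thesis .
qed

lemma scalar_product_scale:
  fixes x y :: "'a::comm_ring_1^'n"
  shows "scalar_product (c *s x) y = c * scalar_product x y"
    and "scalar_product x (c *s y) = c * scalar_product x y"
  by (simp_all add: scalar_product_def sum_distrib_left mult_ac)

lemma scalar_product_diff_right:
  fixes x y :: "'a::comm_ring_1^'n"
  shows "scalar_product x (y - z) = scalar_product x y - scalar_product x z"
  by (simp add: scalar_product_def sum_subtractf algebra_simps)

lemma norm_cnj_vec [simp]: "norm (cnj_vec x) = norm x"
  by (simp add: norm_vec_def cnj_vec_def)

lemma cnj_vec_cnj_vec [simp]: "cnj_vec (cnj_vec x) = x"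
  by (simp add: cnj_vec_def vec_eq_iff)

lemma normalized_eigvecs_iff:
  "normalized_eigvecs M \<mu> x y \<longleftrightarrow>
     cnj_vec x v* M = \<mu> *s cnj_vec x \<and> M *v y = \<mu> *s y \<and> norm x = 1 \<and> norm y = 1 \<and>
     scalar_product (cnj_vec x) y \<in> \<real> \<and> Re (scalar_product (cnj_vec x) y) > 0"
  by (simp add: normalized_eigvecs_def scalar_product_def cnj_vec_def)

text \<open>Left and right eigenvectors of a simple eigenvalue have nonzero pairing, so lengths and
  phase can be rescaled. This gives meaning to the choice made in \<open>G_eps\<close>.\<close>

lemma normalized_eigvecs_exist:
  assumes "simple_eigenvalue M \<mu>"
  shows "\<exists>x y. normalized_eigvecs M \<mu> x y"
proof -
  obtain v where v: "v \<noteq> 0" "M *v v = \<mu> *s v"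
    using assms by (auto simp: simple_eigenvalue_def is_eigenvalue_def)
  have "(mat \<mu> - M) *v v = 0"
    by (simp add: matrix_vector_mult_diff_rdistrib mat_mult_vec v)
  \<comment> \<open>A singular square matrix has kernel vectors on both sides, so the right
    eigenvector yields a left one.\<close>
  then obtain u where u: "u \<noteq> 0" "u v* (mat \<mu> - M) = 0"
    using v(1) det_eq_0_iff_kernel det_eq_0_iff_left_kernel by blast
  then have uM: "u v* M = \<mu> *s u"
    by (simp add: vector_matrix_mult_diff_rdistrib vec_mult_mat)
  define s where "s = scalar_product u v"
  have s: "s \<noteq> 0"
    unfolding s_def by (rule left_right_eigenvectors_not_orthogonal[OF assms v(2,1) uM u(1)])
  \<comment> \<open>The denominator normalizes \<open>u\<close>, and the phase
    \<open>cnj (sgn s)\<close> rotates the pairing \<open>s\<close> onto the positive real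
    axis.\<close>
  define c where "c = cnj (sgn s) / of_real (norm u)"
  define d :: complex where "d = 1 / of_real (norm v)"
  have "sgn s * cnj s = of_real (norm s)"
    using s complex_norm_square[of s]
    by (simp add: sgn_div_norm scaleR_conv_of_real power2_eq_square divide_simps)
  then have "cnj (sgn s) * s = of_real (norm s)"
    by (metis complex_cnj_cnj complex_cnj_mult complex_cnj_complex_of_real)
  then have sp: "scalar_product (c *s u) (d *s v) = of_real (norm s / (norm u * norm v))"
    by (simp add: scalar_product_scale c_def d_def s_def[symmetric])
  have "(c *s u) v* M = c *s (u v* M)"
    by (simp add: vec_eq_iff vector_matrix_mult_def sum_distrib_left mult_ac)
  then have "normalized_eigvecs M \<mu> (cnj_vec (c *s u)) (d *s v)"
    unfolding normalized_eigvecs_iff cnj_vec_cnj_vec norm_cnj_vec sp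
    using s u v uM
    by (auto simp: norm_vector_scalar_mult c_def d_def norm_divide norm_sgn vector_smult_assoc
        mult.commute vector_scalar_commute)
  then show ?thesis by blast
qed

text \<open>Replacing a column is a rank-one correction that sees only the entry
  \<open>u $ k\<close>. On the kernel of \<open>A\<close> nothing but this correction
  remains.\<close>

lemma replace_column_mult_vec:
  fixes A :: "'a::comm_ring_1^'n^'m"
  shows "replace_column A k y *v u = A *v u + u $ k *s (y - column k A)"
proof -
  have "(replace_column A k y *v u) $ i = (A *v u + u $ k *s (y - column k A)) $ i" for i
  proof -
    have "(replace_column A k y *v u) $ i = y $ i * u $ k + (\<Sum>j\<in>UNIV - {k}. A $ i $ j * u $ j)"
      by (simp add: matrix_vector_mult_def replace_column_def sum.remove[of UNIV k])
    moreover have "(A *v u) $ i = A $ i $ k * u $ k + (\<Sum>j\<in>UNIV - {k}. A $ i $ j * u $ j)"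
      by (simp add: matrix_vector_mult_def sum.remove[of UNIV k])
    ultimately show ?thesis by (simp add: column_def algebra_simps)
  qed
  then show ?thesis by (simp add: vec_eq_iff)
qed

text \<open>Scaling the \<open>k\<close>-th entry to \<open>1\<close> selects one eigenvector of
  each nearby matrix, and this vector solves a linear system whose limit is invertible. The nearby
  eigenvalues are not assumed to be simple.\<close>

lemma eigenvectors_tendsto:
  fixes M :: "'b \<Rightarrow> complex^'n^'n"
  assumes M: "(M \<longlongrightarrow> M0) F" and \<mu>: "(\<mu> \<longlongrightarrow> \<mu>0) F"
    and ev: "\<forall>\<^sub>F t in F. is_eigenvalue (M t) (\<mu> t)"
    and simple: "simple_eigenvalue M0 \<mu>0" and y: "M0 *v y = \<mu>0 *s y" "y \<noteq> 0"
  obtains w c where "c \<noteq> 0" "(w \<longlongrightarrow> c *s y) F" "\<forall>\<^sub>F t in F. M t *v w t = \<mu> t *s w t"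
proof -
  obtain k where k: "y $ k \<noteq> 0"
    using y(2) by (auto simp: vec_eq_iff)
  let ?N = "\<lambda>t. mat (\<mu> t) - M t" let ?Nlim = "mat \<mu>0 - M0"
  let ?B = "\<lambda>t. replace_column (?N t) k y" let ?Blim = "replace_column ?Nlim k y"
  define w where "w = (\<lambda>t. SOME u. M t *v u = \<mu> t *s u \<and> u $ k = 1)"
  have N: "(?N \<longlongrightarrow> ?Nlim) F"
    by (intro tendsto_intros tendsto_mat M \<mu>)
  have B: "(?B \<longlongrightarrow> ?Blim) F"
    by (intro tendsto_replace_column N tendsto_const)
  have B0: "det ?Blim \<noteq> 0"
    by (rule det_replace_column_eigenvector_nonzero[OF simple y(1) k])
  have w: "\<forall>\<^sub>F t in F. M t *v w t = \<mu> t *s w t \<and> w t $ k = 1"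
    using ev tendsto_imp_eventually_ne[OF tendsto_det[OF B] B0]
  proof eventually_elim
    case (elim t)
    obtain u where u: "u \<noteq> 0" "M t *v u = \<mu> t *s u"
      using elim(1) by (auto simp: is_eigenvalue_def)
    have "?N t *v u = 0"
      by (simp add: matrix_vector_mult_diff_rdistrib mat_mult_vec u)
    \<comment> \<open>If \<open>u $ k\<close> were zero, \<open>u\<close> would lie in the kernel of
      the invertible matrix \<open>?B t\<close>; hence \<open>u\<close> can be scaled as
      required.\<close>
    then have "?B t *v u = u $ k *s (y - column k (?N t))"
      by (simp add: replace_column_mult_vec)
    moreover have "?B t *v u \<noteq> 0"
      using elim(2) u(1) det_eq_0_iff_kernel by blast
    ultimately have "u $ k \<noteq> 0"
      by auto
    then have "M t *v ((1 / u $ k) *s u) = \<mu> t *s ((1 / u $ k) *s u) \<and> ((1 / u $ k) *s u) $ k = 1"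
      using u(2) by (simp add: vector_scalar_commute vector_smult_assoc mult.commute)
    then show ?case
      unfolding w_def by (rule someI)
  qed
  \<comment> \<open>The limit must be the multiple of \<open>y\<close> whose \<open>k\<close>-th
    entry is \<open>1\<close>.\<close>
  let ?w0 = "(1 / y $ k) *s y"
  have "?Nlim *v ?w0 = 0"
    by (simp add: matrix_vector_mult_diff_rdistrib mat_mult_vec y vector_scalar_commute
        vector_smult_assoc mult.commute)
  then have B0w0: "?Blim *v ?w0 = y - column k ?Nlim"
    using k by (simp add: replace_column_mult_vec)
  have "(w \<longlongrightarrow> ?w0) F"
  proof (rule tendsto_solve_linear_system[OF B _ B0])
    show "((\<lambda>t. y - column k (?N t)) \<longlongrightarrow> ?Blim *v ?w0) F"
      unfolding B0w0 column_def by (intro tendsto_intros tendsto_vec_lambda N)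
    show "\<forall>\<^sub>F t in F. ?B t *v w t = y - column k (?N t)"
      using w
      by eventually_elim
        (simp add: replace_column_mult_vec matrix_vector_mult_diff_rdistrib mat_mult_vec)
  qed
  moreover have "\<forall>\<^sub>F t in F. M t *v w t = \<mu> t *s w t"
    using w by (rule eventually_mono) simp
  ultimately show thesis
    using that[of "1 / y $ k" w] k by simp
qed

text \<open>Pairing the eigenvalue equation at \<open>s\<close> with the left eigenvector at
  \<open>t\<close> gives an exact formula for the difference quotient of \<open>\<mu>\<close>. The
  nearby eigenvectors \<open>w s\<close> then only have to converge, not to be
  differentiable.\<close>

lemma simple_eigenvalue_has_vector_derivative:
  fixes M :: "real \<Rightarrow> complex^'n^'n"
  assumes M: "(M has_vector_derivative M') (at t)" and \<mu>: "isCont \<mu> t"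
    and ev: "\<And>s. is_eigenvalue (M s) (\<mu> s)"
    and simple: "simple_eigenvalue (M t) (\<mu> t)"
    and right: "M t *v y = \<mu> t *s y" "y \<noteq> 0"
    and left: "x v* M t = \<mu> t *s x" "x \<noteq> 0"
  shows "(\<mu> has_vector_derivative scalar_product x (M' *v y) / scalar_product x y) (at t)"
proof -
  have lim: "(M \<longlongrightarrow> M t) (at t)" "(\<mu> \<longlongrightarrow> \<mu> t) (at t)"
    using has_vector_derivative_continuous[OF M] \<mu> by (auto simp: continuous_at)
  obtain w c where c: "c \<noteq> 0" and w: "(w \<longlongrightarrow> c *s y) (at t)"
    and w_ev: "\<forall>\<^sub>F s in at t. M s *v w s = \<mu> s *s w s"
    by (rule eigenvectors_tendsto[OF lim always_eventually[OF allI[OF ev]] simple right])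
  have xy: "scalar_product x y \<noteq> 0"
    by (rule left_right_eigenvectors_not_orthogonal[OF simple right left])
  have xw: "((\<lambda>s. scalar_product x (w s)) \<longlongrightarrow> scalar_product x (c *s y)) (at t)"
    by (intro tendsto_scalar_product tendsto_const w)
  have xcy: "scalar_product x (c *s y) \<noteq> 0"
    using c xy by (simp add: scalar_product_scale)
  let ?Q = "\<lambda>s. (M s - M t) /\<^sub>R (s - t)"
  have "((\<lambda>s. scalar_product x (?Q s *v w s) / scalar_product x (w s)) \<longlongrightarrow>
      scalar_product x (M' *v (c *s y)) / scalar_product x (c *s y)) (at t)"
    using M[unfolded has_vector_derivative_iff_quotient]
    by (intro tendsto_divide tendsto_scalar_product tendsto_matrix_vector_mult tendsto_const w xcy)
  \<comment> \<open>The unknown scale \<open>c\<close> of the limiting eigenvector cancels.\<close>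
  moreover have "scalar_product x (M' *v (c *s y)) / scalar_product x (c *s y) =
      scalar_product x (M' *v y) / scalar_product x y"
    using c by (simp add: vector_scalar_commute scalar_product_scale)
  moreover have "\<forall>\<^sub>F s in at t. scalar_product x (?Q s *v w s) / scalar_product x (w s) =
      (\<mu> s - \<mu> t) /\<^sub>R (s - t)"
    using w_ev tendsto_imp_eventually_ne[OF xw xcy]
  proof eventually_elim
    case (elim s)
    have "scalar_product x ((M s - M t) *v w s) = (\<mu> s - \<mu> t) * scalar_product x (w s)"
      using elim(1)
      by (simp add: matrix_vector_mult_diff_rdistrib scalar_product_diff_right scalar_product_scale
          left_diff_distrib left(1) flip: scalar_product_vector_matrix[of x "M t"])
    moreover have "?Q s *v w s = of_real (1 / (s - t)) *s ((M s - M t) *v w s)"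
      by (simp add: vec_eq_iff matrix_vector_mult_def sum_distrib_left
          scaleR_conv_of_real[where 'a=complex] divide_inverse mult.assoc)
    ultimately show ?case
      using elim(2) by (simp add: scalar_product_scale scaleR_conv_of_real divide_inverse)
  qed
  ultimately show ?thesis
    unfolding has_vector_derivative_iff_quotient by (simp add: Lim_transform_eventually)
qed

subsection \<open>The derivative of the functional along a path\<close>

text \<open>As \<open>Im (g z)\<close> is constantly zero, \<open>a = g' 1\<close> and
  \<open>b = g' \<i>\<close> are real. Twice the Wirtinger derivative is
  \<open>a + \<i> * b\<close>, and the real part of its conjugate times \<open>h\<close> is
  \<open>a * Re h + b * Im h\<close>.\<close>

lemma derivative_real_valued_complex:
  assumes g: "(g has_derivative g') (at z)" and real: "\<And>z. g z \<in> \<real>"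
  shows "g' h = of_real (Re (2 * cnj (wirtinger_cnj g z) * h))"
proof -
  interpret g': bounded_linear g'
    using g by (rule has_derivative_bounded_linear)
  have "((\<lambda>z. Im (g z)) has_derivative (\<lambda>h. Im (g' h))) (at z)"
    using g by (rule has_derivative_Im)
  moreover have "(\<lambda>z. Im (g z)) = (\<lambda>z. 0)"
    using real by (auto simp: complex_is_Real_iff)
  ultimately have "((\<lambda>z. 0 :: real) has_derivative (\<lambda>h. Im (g' h))) (at z)"
    by simp
  then have "(\<lambda>h. Im (g' h)) = (\<lambda>h. 0)"
    using has_derivative_unique has_derivative_const by blast
  then have Im: "Im (g' h) = 0" for h
    by meson
  have "h = Re h *\<^sub>R 1 + Im h *\<^sub>R \<i>"
    by (simp add: complex_eq_iff)
  then have "g' h = g' (Re h *\<^sub>R 1 + Im h *\<^sub>R \<i>)"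
    by (rule arg_cong)
  also have "\<dots> = Re h *\<^sub>R g' 1 + Im h *\<^sub>R g' \<i>"
    by (simp only: g'.add g'.scaleR)
  finally show ?thesis
    using Im[of 1] Im[of \<i>]
    by (simp add: wirtinger_cnj_def complex_eq_iff algebra_simps flip: frechet_derivative_at[OF g])
qed

lemma smooth_fun_differentiable:
  assumes "smooth_fun f"
  shows "f differentiable (at x)"
  using assms by (auto simp: smooth_fun_def dest: spec[of _ "Suc 0"])

lemma derivative_real_valued_vector:
  assumes "g differentiable (at (l t))" and real: "\<And>z. g z \<in> \<real>"
    and l: "(l has_vector_derivative l') (at t)"
  shows "((\<lambda>t. g (l t)) has_vector_derivative of_real (Re (2 * cnj (wirtinger_cnj g (l t)) * l'))) (at t)"
proof -
  obtain g' where g': "(g has_derivative g') (at (l t))"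
    using assms(1) by (auto simp: differentiable_def)
  have "((\<lambda>t. g (l t)) has_derivative (\<lambda>h. g' (h *\<^sub>R l'))) (at t)"
    using l g' unfolding has_vector_derivative_def by (rule has_derivative_compose)
  then show ?thesis
    unfolding has_vector_derivative_def linear_scale[OF has_derivative_linear[OF g']]
    by (simp only: derivative_real_valued_complex[OF g' real])
qed

text \<open>Pairing the rank-one gradient with a direction \<open>Z\<close> produces the numerator
  in the derivative of the eigenvalue.\<close>

lemma frob_inner_rank_one:
  "frob_inner (\<chi> i j. c * (x $ i * cnj (y $ j))) Z = cnj c * scalar_product (cnj_vec x) (Z *v y)"
proof -
  have "frob_inner (\<chi> i j. c * (x $ i * cnj (y $ j))) Z =
      (\<Sum>j\<in>UNIV. \<Sum>i\<in>UNIV. cnj c * (cnj (x $ i) * (Z $ i $ j * y $ j)))"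
    by (simp add: frob_inner_def trace_def conj_transpose_def matrix_matrix_mult_def mult_ac)
  also have "\<dots> = cnj c * scalar_product (cnj_vec x) (Z *v y)"
    by (subst sum.swap)
      (simp add: scalar_product_def cnj_vec_def matrix_vector_mult_def sum_distrib_left)
  finally show ?thesis .
qed

text \<open>The chain rule combines the derivatives of the eigenvalue and of
  \<open>f (z, cnj z)\<close>. The normalization makes \<open>\<kappa> = x\<^sup>* y\<close> a
  positive real, so it leaves the real part as a factor; its sign is all that matters for the zeros
  of the derivative.\<close>

lemma F_eps_has_vector_derivative:
  fixes A :: "complex^'n^'n"
  assumes ev: "\<And>M. is_eigenvalue M (lam M)"
    and simple: "simple_eigenvalue (A + \<epsilon> *\<^sub>R E t) (lam (A + \<epsilon> *\<^sub>R E t))"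
    and cont: "isCont (\<lambda>X. lam (A + \<epsilon> *\<^sub>R X)) (E t)"
    and E: "(E has_vector_derivative E') (at t)"
    and f: "smooth_fun f" and real: "\<And>z. f (z, cnj z) \<in> \<real>"
  obtains \<kappa> where "\<kappa> > 0"
    "((\<lambda>t. F_eps f lam A \<epsilon> (E t)) has_vector_derivative
        of_real (\<epsilon> / \<kappa> * Re (frob_inner (G_eps f lam A \<epsilon> (E t)) E'))) (at t)"
proof -
  define M where "M = (\<lambda>s. A + \<epsilon> *\<^sub>R E s)"
  define l where "l = (\<lambda>s. lam (M s))"
  define g where "g = (\<lambda>z. f (z, cnj z))"
  \<comment> \<open>This is the very pair chosen in \<open>G_eps\<close>, so the resulting
    derivative can be matched with the gradient.\<close>
  define p where "p = (SOME (x, y). normalized_eigvecs (M t) (l t) x y)"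
  obtain x y where p: "p = (x, y)"
    by fastforce
  have "\<exists>p. case p of (x, y) \<Rightarrow> normalized_eigvecs (M t) (l t) x y"
    using normalized_eigvecs_exist[OF simple] by (auto simp: M_def l_def)
  from someI_ex[OF this] have xy: "normalized_eigvecs (M t) (l t) x y"
    unfolding p_def[symmetric] p by simp
  define \<kappa> where "\<kappa> = Re (scalar_product (cnj_vec x) y)"
  have \<kappa>: "\<kappa> > 0" "scalar_product (cnj_vec x) y = of_real \<kappa>"
    using xy by (auto simp: normalized_eigvecs_iff \<kappa>_def)
  have nz: "y \<noteq> 0" "cnj_vec x \<noteq> 0"
    using xy norm_cnj_vec[of x] by (auto simp: normalized_eigvecs_iff simp del: norm_cnj_vec)
  have M: "(M has_vector_derivative \<epsilon> *\<^sub>R E') (at t)"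
    unfolding M_def by (auto intro!: derivative_eq_intros E)
  have "isCont l t"
    unfolding l_def M_def
    by (rule isCont_o2[OF has_vector_derivative_continuous[OF E] cont])
  then have l: "(l has_vector_derivative
      scalar_product (cnj_vec x) ((\<epsilon> *\<^sub>R E') *v y) / of_real \<kappa>) (at t)"
    using simple_eigenvalue_has_vector_derivative[OF M, of l y "cnj_vec x"] xy nz ev simple \<kappa>(2)
    by (simp add: normalized_eigvecs_iff l_def M_def)
  have "(\<epsilon> *\<^sub>R E') *v y = of_real \<epsilon> *s (E' *v y)"
    by (simp add: vec_eq_iff matrix_vector_mult_def sum_distrib_left
        scaleR_conv_of_real[where 'a=complex] mult.assoc)
  with l have l: "(l has_vector_derivative
      of_real (\<epsilon> / \<kappa>) * scalar_product (cnj_vec x) (E' *v y)) (at t)"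
    by (simp add: scalar_product_scale)
  have "g differentiable (at z)" for z
    unfolding g_def
    by (rule differentiable_compose[of f, OF smooth_fun_differentiable[OF f]])
      (auto simp: differentiable_def intro!: exI derivative_eq_intros)
  from derivative_real_valued_vector[OF this _ l] real
  have "((\<lambda>t. g (l t)) has_vector_derivative of_real (Re (2 * cnj (wirtinger_cnj g (l t)) *
      (of_real (\<epsilon> / \<kappa>) * scalar_product (cnj_vec x) (E' *v y))))) (at t)"
    by (simp add: g_def)
  moreover have "G_eps f lam A \<epsilon> (E t) =
      (\<chi> i j. 2 * wirtinger_cnj g (l t) * (x $ i * cnj (y $ j)))"
    using p[unfolded p_def l_def M_def] by (simp add: G_eps_def Let_def g_def l_def M_def)
  then have "frob_inner (G_eps f lam A \<epsilon> (E t)) E' =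
      2 * cnj (wirtinger_cnj g (l t)) * scalar_product (cnj_vec x) (E' *v y)"
    by (simp add: frob_inner_rank_one)
  then have "2 * cnj (wirtinger_cnj g (l t)) *
      (of_real (\<epsilon> / \<kappa>) * scalar_product (cnj_vec x) (E' *v y)) =
      of_real (\<epsilon> / \<kappa>) * frob_inner (G_eps f lam A \<epsilon> (E t)) E'"
    by (simp add: mult_ac)
  moreover have "Re (of_real r * z) = r * Re z" for r z
    by simp
  ultimately have "((\<lambda>t. g (l t)) has_vector_derivative
      of_real (\<epsilon> / \<kappa> * Re (frob_inner (G_eps f lam A \<epsilon> (E t)) E'))) (at t)"
    by metis
  moreover have "(\<lambda>t. g (l t)) = (\<lambda>t. F_eps f lam A \<epsilon> (E t))"
    by (simp add: F_eps_def g_def l_def M_def Let_def)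
  ultimately show thesis
    using that \<kappa>(1) by simp
qed

section \<open>Equivalence of vanishing derivative, stationarity and proportionality\<close>

theorem theorem2p11:
  fixes A Estar :: "complex^'n^'n"
    and \<epsilon> t0 :: real
    and S :: "(complex^'n^'n) set"
    and lam :: "complex^'n^'n \<Rightarrow> complex"
    and f :: "complex \<times> complex \<Rightarrow> complex"
    and E :: "real \<Rightarrow> complex^'n^'n"
    and T :: "real set"
  assumes "\<epsilon> > 0"
    and "subspace S"
    and "smooth_fun f"
    and "\<And>z. f (z, cnj z) = f (cnj z, z)"
    and "\<And>z. f (z, cnj z) \<in> \<real>"
    and "\<And>M. is_eigenvalue M (lam M)"
    and "Estar \<in> S"
    and "frob_norm Estar = 1"
    and "simple_eigenvalue (A + \<epsilon> *\<^sub>R Estar) (lam (A + \<epsilon> *\<^sub>R Estar))"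
    and "\<forall>\<^sub>F X in nhds Estar. isCont (\<lambda>X. lam (A + \<epsilon> *\<^sub>R X)) X"
    and "GS_eps S f lam A \<epsilon> Estar \<noteq> 0"
    and "open T" and "is_interval T" and "t0 \<in> T"
    and "\<And>t. t \<in> T \<Longrightarrow> E t \<in> S"
    and "ode_solution_on T (flow_rhs S f lam A \<epsilon>) E"
    and "E t0 = Estar"
  shows "(((\<lambda>t. F_eps f lam A \<epsilon> (E t)) has_vector_derivative 0) (at t0)
           \<longleftrightarrow> stationary_point (flow_rhs S f lam A \<epsilon>) Estar)
       \<and> (stationary_point (flow_rhs S f lam A \<epsilon>) Estar
           \<longleftrightarrow> (\<exists>c::real. Estar = c *\<^sub>R GS_eps S f lam A \<epsilon> Estar))"
proof -
  let ?G = "GS_eps S f lam A \<epsilon> Estar"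
  define D where "D = flow_rhs S f lam A \<epsilon> Estar"
  have EE: "inner Estar Estar = 1"
    using assms(8) by (simp add: frob_norm_eq_norm norm_eq_1)
  have D: "D = - ?G + inner ?G Estar *\<^sub>R Estar"
    by (simp add: D_def flow_rhs_def Re_frob_inner)
  \<comment> \<open>Directions in \<open>S\<close> do not distinguish the gradient from its
    projection.\<close>
  have G: "?G \<in> S" "\<And>W. W \<in> S \<Longrightarrow> inner (G_eps f lam A \<epsilon> Estar) W = inner ?G W"
    using frob_proj[OF assms(2), of "G_eps f lam A \<epsilon> Estar"]
    by (auto simp: GS_eps_def Re_frob_inner inner_diff_left)
  have "D \<in> S"
    unfolding D by (intro subspace_add subspace_neg subspace_scale assms G)
  have GD: "Re (frob_inner (G_eps f lam A \<epsilon> Estar) D) = - inner D D"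
  proof -
    \<comment> \<open>Since \<open>Estar\<close> has norm one, \<open>-D\<close> is the component of
      \<open>?G\<close> orthogonal to \<open>Estar\<close>.\<close>
    have "inner ?G D = - inner D D"
      unfolding D using EE by (simp add: inner_simps inner_commute algebra_simps)
    then show ?thesis
      using G(2)[OF \<open>D \<in> S\<close>] by (simp add: Re_frob_inner)
  qed
  \<comment> \<open>As \<open>T\<close> is open, the derivative within \<open>T\<close> is an
    ordinary derivative.\<close>
  have E: "(E has_vector_derivative D) (at t0)"
    using assms(16) assms(14,17) at_within_open[OF assms(14,12)]
    by (auto simp: ode_solution_on_def D_def)
  obtain \<kappa> where \<kappa>: "\<kappa> > 0" and F: "((\<lambda>t. F_eps f lam A \<epsilon> (E t)) has_vector_derivative
      of_real (\<epsilon> / \<kappa> * Re (frob_inner (G_eps f lam A \<epsilon> (E t0)) D))) (at t0)"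
    using F_eps_has_vector_derivative[of lam A \<epsilon> E t0 D f] assms(3,5,6,9,17) E
      eventually_nhds_x_imp_x[OF assms(10)] by metis
  have "((\<lambda>t. F_eps f lam A \<epsilon> (E t)) has_vector_derivative 0) (at t0) \<longleftrightarrow>
      complex_of_real (\<epsilon> / \<kappa> * Re (frob_inner (G_eps f lam A \<epsilon> (E t0)) D)) = 0"
    using F vector_derivative_unique_at[OF F] by metis
  also have "\<dots> \<longleftrightarrow> D = 0"
    using assms(1,17) \<kappa> GD by simp
  finally have 12: "((\<lambda>t. F_eps f lam A \<epsilon> (E t)) has_vector_derivative 0) (at t0) \<longleftrightarrow> D = 0" .
  have "D = 0 \<longleftrightarrow> (\<exists>c. Estar = c *\<^sub>R ?G)"
  proof
    assume "D = 0"
    then have *: "?G = inner ?G Estar *\<^sub>R Estar"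
      by (simp add: D)
    \<comment> \<open>A zero coefficient would make \<open>?G\<close> vanish. Its inverse is the
      multiple sought.\<close>
    with assms(11) have "inner ?G Estar \<noteq> 0"
      by (metis scaleR_zero_left)
    then have "Estar = inverse (inner ?G Estar) *\<^sub>R (inner ?G Estar *\<^sub>R Estar)"
      by simp
    also have "\<dots> = inverse (inner ?G Estar) *\<^sub>R ?G"
      using *[symmetric] by (rule arg_cong)
    finally show "\<exists>c. Estar = c *\<^sub>R ?G" ..
  next
    assume "\<exists>c. Estar = c *\<^sub>R ?G"
    then obtain c where c: "Estar = c *\<^sub>R ?G" ..
    \<comment> \<open>Moving \<open>c\<close> into the inner product turns the coefficient of
      \<open>?G\<close> into \<open>inner Estar Estar\<close>, which is \<open>1\<close>.\<close>
    have "inner ?G Estar *\<^sub>R Estar = inner ?G Estar *\<^sub>R (c *\<^sub>R ?G)"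
      using c by (rule arg_cong)
    also have "\<dots> = inner (c *\<^sub>R ?G) Estar *\<^sub>R ?G"
      by (simp add: mult.commute)
    also have "inner (c *\<^sub>R ?G) Estar = 1"
      using EE by (simp flip: c)
    finally have "inner ?G Estar *\<^sub>R Estar = ?G"
      by simp
    then show "D = 0"
      by (simp add: D)
  qed
  with 12 show ?thesis
    by (simp add: stationary_point_def D_def)
qed

end
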